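(* Let $\gamma\in(0,1)$ and let $\rho(w,t)$ be a solution of the modified Yard-Sale Model equation $$\frac{\partial \rho(w,t)}{\partial t}=\frac{\partial^2}{\partial w^2}\Big[D[w,\rho(\cdot,t)]\,\rho(w,t)\Big],\qquad D[w,\rho(\cdot,t)]:=\frac{\gamma}{2}\int_0^\infty \kappa(w,x)\rho(x,t)\,dx,$$ where $\kappa(w,x)=(w\wedge x)^2$ if $w\wedge x<1$ and $\kappa(w,x)=w\wedge x$ if $w\wedge x\ge 1$. Let $$G(t):=1-\int_0^\infty\int_0^\infty (w\wedge x)\,\rho(w,t)\rho(x,t)\,dx\,dw$$ be its Gini coefficient. Let $T>0$ and suppose $$M_T:=\sup_{t\in[0,T]}\|\rho(\cdot,t)\|_\infty<\infty.$$ Then for $t\in(0,T]$, $$G(t)\le G(0)\exp(-\gamma M_T t)+\frac{\exp(\gamma M_T t)-1}{\exp(\gamma M_T t)}.$$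
   Context: Here $w\wedge x:=\min(w,x)$, $\mathbb{R}^+$ is the positive half-line, and $\|\cdot\|_\infty$ is the $L^\infty(\mathbb{R}^+)$ norm. For each $t$, $\rho(\cdot,t)$ is a probability density on $\mathbb{R}^+$ (the distribution of agents in dimensionless wealth $w$, all wealths positive) normalized to have unit zeroth and first moments: $\int_0^\infty\rho(w,t)\,dw=1$ and $\int_0^\infty w\,\rho(w,t)\,dw=1$; both moments are conserved by the dynamics. *)

theory Defs
  imports "HOL-Probability.Essential_Supremum"
begin

definition wealth_density :: "(real \<Rightarrow> real) \<Rightarrow> bool" where
  "wealth_density f \<longleftrightarrow>
     (\<forall>w>0. 0 \<le> f w) \<and>
     set_integrable lborel {0<..} f \<and> (LBINT w:{0<..}. f w) = 1 \<and>
     set_integrable lborel {0<..} (\<lambda>w. w * f w) \<and> (LBINT w:{0<..}. w * f w) = 1"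

definition kappa :: "real \<Rightarrow> real \<Rightarrow> real" where
  "kappa w x = (if min w x < 1 then (min w x)\<^sup>2 else min w x)"

definition diffusion :: "real \<Rightarrow> (real \<Rightarrow> real) \<Rightarrow> real \<Rightarrow> real" where
  "diffusion \<gamma> f w = \<gamma> / 2 * (LBINT x:{0<..}. kappa w x * f x)"

(* Classical solution on (0,\<infinity>) x (0,T]; the function r is the common value of both sides
   of the equation.  No smoothness of \<rho>(\<sqdot>,t) itself is required: D has a kink at w = 1,
   so it is the product D \<rho>, and not \<rho>, that is twice differentiable in w.
   At t = T the time derivative is one-sided.  The initial datum is attained in L^1, so that
   \<rho>(\<sqdot>,0) need not be continuous. *)
definition yard_sale_solution :: "real \<Rightarrow> real \<Rightarrow> (real \<Rightarrow> real \<Rightarrow> real) \<Rightarrow> bool" where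
  "yard_sale_solution \<gamma> T \<rho> \<longleftrightarrow>
     continuous_on ({0<..} \<times> {0<..T}) (\<lambda>(w, t). \<rho> w t) \<and>
     (\<exists>r. continuous_on ({0<..} \<times> {0<..T}) (\<lambda>(w, t). r w t) \<and>
        (\<forall>w>0. \<forall>t\<in>{0<..T}.
           ((\<lambda>s. \<rho> w s) has_real_derivative r w t) (at t within {0<..T}) \<and>
           (\<lambda>y. diffusion \<gamma> (\<lambda>x. \<rho> x t) y * \<rho> y t) field_differentiable (at w) \<and>
           (deriv (\<lambda>y. diffusion \<gamma> (\<lambda>x. \<rho> x t) y * \<rho> y t)
              has_real_derivative r w t) (at w))) \<and>
     ((\<lambda>t. LBINT w:{0<..}. \<bar>\<rho> w t - \<rho> w 0\<bar>) \<longlongrightarrow> 0) (at_right 0)"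

definition gini :: "(real \<Rightarrow> real) \<Rightarrow> real" where
  "gini f = 1 - (LBINT w:{0<..}. LBINT x:{0<..}. min w x * f w * f x)"

definition Linf_norm :: "(real \<Rightarrow> real) \<Rightarrow> ereal" where
  "Linf_norm f = esssup (restrict_space lborel {0<..}) (\<lambda>w. ereal \<bar>f w\<bar>)"

definition sup_norm_upto :: "real \<Rightarrow> (real \<Rightarrow> real \<Rightarrow> real) \<Rightarrow> ereal" where
  "sup_norm_upto T \<rho> = (SUP t\<in>{0..T}. Linf_norm (\<lambda>w. \<rho> w t))"

end

(* Let A_t(x) be the integral of (w /\ x) rho(w,t) dw, and F = 1 - G, so that F(t) is the integral of
   A_t rho(.,t).  As a function of w, w /\ x has second derivative minus the Dirac mass at x, so
   formally d/dt A_t(x) = - D rho(x,t), and D <= (gamma/2) A_t because kappa(w,x) <= w /\ x.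
   By the symmetry of w /\ x, F(t) - F(s) is the integral of (A_t - A_s)(rho(.,t) + rho(.,s)),
   whence F(t) - F(s) >= - gamma M times the integral of F over [s,t]; Gronwall's lemma gives
   F(t) >= F(s) exp(- gamma M (t - s)), and s -> 0 by L^1 continuity of F.

   The derivatives of D rho are uncontrolled near 0 and infinity, so A_t - A_s is reached through
   piecewise linear, compactly supported approximations of w /\ x (tents).  Their second derivatives
   are combinations of Dirac masses; the unwanted one of negative sign has weight at most x/R and
   acts on D rho <= gamma M / 2, so that it disappears as R -> infinity. *)
theory Submission
  imports Defs "HOL-Real_Asymp.Real_Asymp"
begin

section \<open>Densities extended by zero and the bilinear form behind the Gini coefficient\<close>

text \<open>Values at nonpositive wealth, which \<open>wealth_density\<close> leaves arbitrary, are
  fixed at 0. All integrals can then be taken over the whole line, with sign conditions that hold at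
  every point.\<close>

definition extended_density :: "(real \<Rightarrow> real) \<Rightarrow> bool" where
  "extended_density f \<longleftrightarrow>
     (\<forall>w. 0 \<le> f w) \<and> (\<forall>w\<le>0. f w = 0) \<and>
     integrable lborel f \<and> (\<integral>w. f w \<partial>lborel) = 1 \<and>
     integrable lborel (\<lambda>w. w * f w) \<and> (\<integral>w. w * f w \<partial>lborel) = 1"

text \<open>This is A_t of the overview, the limited expected value of probability theory: for a
  density and \<open>w\<close> nonnegative it is the integral over [0, w] of the tail of the
  distribution.\<close>

definition mean_min :: "(real \<Rightarrow> real) \<Rightarrow> real \<Rightarrow> real" where
  "mean_min f w = (\<integral>x. min w x * f x \<partial>lborel)"

definition overlap :: "(real \<Rightarrow> real) \<Rightarrow> (real \<Rightarrow> real) \<Rightarrow> real" where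
  "overlap f g = (\<integral>w. mean_min f w * g w \<partial>lborel)"

lemma extended_density_if:
  assumes "wealth_density f"
  shows "extended_density (\<lambda>w. if 0 < w then f w else 0)"
proof -
  have eq: "(\<lambda>w. indicator {0<..} w *\<^sub>R f w) = (\<lambda>w. if 0 < w then f w else 0)"
    "(\<lambda>w. indicator {0<..} w *\<^sub>R (w * f w)) = (\<lambda>w. w * (if 0 < w then f w else 0))"
    by (auto simp: indicator_def)
  show ?thesis
    using assms
    unfolding wealth_density_def extended_density_def set_integrable_def set_lebesgue_integral_def eq
    by auto
qed

lemma gini_eq_overlap:
  fixes f :: "real \<Rightarrow> real"
  defines "p \<equiv> (\<lambda>w. if 0 < w then f w else 0)"
  shows "gini f = 1 - overlap p p"
proof -
  have "indicator {0<..} w *\<^sub>R (LBINT x:{0<..}. min w x * f w * f x) = mean_min p w * p w" for w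
  proof (cases "0 < w")
    case True
    have "(LBINT x:{0<..}. min w x * f w * f x) = (\<integral>x. f w * (min w x * p x) \<partial>lborel)"
      unfolding set_lebesgue_integral_def p_def
      by (intro Bochner_Integration.integral_cong) (auto simp: indicator_def)
    also have "\<dots> = f w * mean_min p w"
      unfolding mean_min_def by simp
    finally show ?thesis using True by (simp add: p_def)
  qed (simp add: p_def)
  then show ?thesis
    unfolding gini_def overlap_def set_lebesgue_integral_def by (simp only:)
qed

context
  fixes f assumes f: "extended_density f"
begin

lemma extended_density_measurable: "f \<in> borel_measurable borel"
  using f by (auto simp: extended_density_def)

lemma extended_density_nonneg: "0 \<le> f w"
  using f by (simp add: extended_density_def)

lemma extended_density_eq_0: "w \<le> 0 \<Longrightarrow> f w = 0"
  using f by (simp add: extended_density_def)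

text \<open>The first moment serves as the majorant: it gives both the integrability behind
  \<open>mean_min\<close> and the bound \<open>mean_min f w\<close> at most 1.\<close>

lemma abs_min_mult_density_le:
  assumes "0 \<le> w"
  shows "\<bar>min w x * f x\<bar> \<le> x * f x"
proof (cases "x \<le> 0")
  case False
  then have "\<bar>min w x * f x\<bar> = min w x * f x"
    using assms extended_density_nonneg by simp
  then show ?thesis using extended_density_nonneg by (simp add: mult_right_mono)
qed (simp add: extended_density_eq_0)

lemma integrable_min_mult_density:
  assumes "0 \<le> w"
  shows "integrable lborel (\<lambda>x. min w x * f x)"
proof (rule Bochner_Integration.integrable_bound)
  note [measurable] = extended_density_measurable
  show "(\<lambda>x. min w x * f x) \<in> borel_measurable lborel"
    by measurable
  show "integrable lborel (\<lambda>x. x * f x)"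
    using f by (simp add: extended_density_def)
  show "AE x in lborel. norm (min w x * f x) \<le> norm (x * f x)"
    using abs_min_mult_density_le[OF assms] by (simp add: order_trans[OF _ abs_ge_self])
qed

lemma mean_min_nonneg:
  assumes "0 \<le> w"
  shows "0 \<le> mean_min f w"
  unfolding mean_min_def
proof (rule Bochner_Integration.integral_nonneg)
  show "0 \<le> min w x * f x" for x
    using assms extended_density_nonneg[of x] extended_density_eq_0[of x] by (cases "x \<le> 0") auto
qed

lemma mean_min_le_1:
  assumes "0 \<le> w"
  shows "mean_min f w \<le> 1"
proof -
  have "mean_min f w \<le> (\<integral>x. x * f x \<partial>lborel)"
    unfolding mean_min_def
    by (intro integral_mono integrable_min_mult_density assms)
      (use f abs_min_mult_density_le[OF assms] in \<open>auto simp: extended_density_def abs_le_iff\<close>)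
  then show ?thesis using f by (simp add: extended_density_def)
qed

lemma mean_min_measurable: "mean_min f \<in> borel_measurable borel"
proof -
  note [measurable] = extended_density_measurable
  show ?thesis unfolding mean_min_def by measurable
qed

end

text \<open>The form of \<open>kappa\<close> enters only here: squaring shrinks the numbers in
  (0,1), so \<open>kappa w x\<close> lies between 0 and \<open>min w x\<close>. Later estimates know
  the diffusion coefficient through these two bounds alone.\<close>

lemma diffusion_le:
  fixes f :: "real \<Rightarrow> real"
  defines "p \<equiv> (\<lambda>w. if 0 < w then f w else 0)"
  assumes p: "extended_density p" and w: "0 < w" and g: "0 \<le> \<gamma>"
  shows "0 \<le> diffusion \<gamma> f w" "diffusion \<gamma> f w \<le> \<gamma> / 2 * mean_min p w"
proof -
  have int: "integrable lborel (\<lambda>x. min w x * p x)"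
    by (rule integrable_min_mult_density[OF p]) (use w in simp)
  have k: "0 \<le> kappa w x \<and> kappa w x \<le> min w x" if "0 < x" for x
  proof -
    have "y\<^sup>2 \<le> y" if "0 < y" "y < 1" for y :: real
      using that by (simp add: power2_eq_square mult_le_cancel_left2)
    then show ?thesis using w \<open>0 < x\<close> by (auto simp: kappa_def min_def not_less)
  qed
  have p0: "0 \<le> p x" for x using p by (simp add: extended_density_def)
  have f0: "0 \<le> f x" if "0 < x" for x using p0[of x] that by (simp add: p_def)
  have "(LBINT x:{0<..}. kappa w x * f x) \<le> mean_min p w"
    unfolding mean_min_def set_lebesgue_integral_def
    \<comment> \<open>\<open>integral_mono'\<close> asks for integrability of the nonnegative
      majorant only; a left integrand that failed to be integrable would have integral 0.\<close>
    by (rule integral_mono'[OF int]) (use k f0 w in \<open>auto simp: indicator_def p_def intro!: mult_right_mono\<close>)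
  then show "diffusion \<gamma> f w \<le> \<gamma> / 2 * mean_min p w"
    unfolding diffusion_def using g by (intro mult_left_mono) auto
  have "0 \<le> (LBINT x:{0<..}. kappa w x * f x)"
    unfolding set_lebesgue_integral_def
    by (rule Bochner_Integration.integral_nonneg) (use k f0 in \<open>auto simp: indicator_def\<close>)
  then show "0 \<le> diffusion \<gamma> f w"
    unfolding diffusion_def using g by simp
qed

lemma integrable_mean_min_mult:
  assumes f: "extended_density f" and g: "extended_density g"
  shows "integrable lborel (\<lambda>w. mean_min f w * g w)"
proof (rule Bochner_Integration.integrable_bound[where f = g])
  show "(\<lambda>w. mean_min f w * g w) \<in> borel_measurable lborel"
    using extended_density_measurable[OF g] mean_min_measurable[OF f] by simp
  have "\<bar>mean_min f w * g w\<bar> \<le> g w" for w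
    using mean_min_nonneg[OF f, of w] mean_min_le_1[OF f, of w] extended_density_nonneg[OF g, of w]
      extended_density_eq_0[OF g, of w]
    by (cases "w \<le> 0") (auto simp: abs_mult mult_left_le_one_le)
  then show "AE w in lborel. norm (mean_min f w * g w) \<le> norm (g w)"
    using extended_density_nonneg[OF g] by simp
qed (use g in \<open>simp add: extended_density_def\<close>)

lemma overlap_nonneg:
  assumes f: "extended_density f" and g: "extended_density g"
  shows "0 \<le> overlap f g"
  unfolding overlap_def
proof (rule Bochner_Integration.integral_nonneg)
  show "0 \<le> mean_min f w * g w" for w
    using mean_min_nonneg[OF f, of w] extended_density_nonneg[OF g, of w]
      extended_density_eq_0[OF g, of w]
    by (cases "w \<le> 0") auto
qed

lemma overlap_le_1:
  assumes f: "extended_density f" and g: "extended_density g"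
  shows "overlap f g \<le> 1"
proof -
  have "overlap f g \<le> (\<integral>w. g w \<partial>lborel)"
    unfolding overlap_def
  proof (intro integral_mono integrable_mean_min_mult f g)
    show "mean_min f w * g w \<le> g w" for w
      using mean_min_nonneg[OF f, of w] mean_min_le_1[OF f, of w] extended_density_nonneg[OF g, of w]
        extended_density_eq_0[OF g, of w]
      by (cases "w \<le> 0") (auto simp: mult_left_le_one_le)
  qed (use g in \<open>simp add: extended_density_def\<close>)
  then show ?thesis using g by (simp add: extended_density_def)
qed

text \<open>Fubini for the symmetric kernel \<open>min\<close>. Absolute integrability is a matter
  of sign: where both densities can be nonzero the integrand is nonnegative, so its inner absolute
  integral is \<open>mean_min g x * f x\<close> again.\<close>

lemma overlap_commute:
  assumes f: "extended_density f" and g: "extended_density g"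
  shows "overlap f g = overlap g f"
proof -
  note [measurable] = extended_density_measurable[OF f] extended_density_measurable[OF g]
  have int: "integrable (lborel \<Otimes>\<^sub>M lborel) (\<lambda>(x, w). min w x * f x * g w)"
  proof (rule lborel_pair.Fubini_integrable)
    have "(\<lambda>x. \<integral>w. norm (min w x * f x * g w) \<partial>lborel) = (\<lambda>x. mean_min g x * f x)"
    proof
      fix x
      have "norm (min w x * f x * g w) = f x * (min x w * g w)" for w
        using extended_density_nonneg[OF f, of x] extended_density_nonneg[OF g, of w]
          extended_density_eq_0[OF f, of x] extended_density_eq_0[OF g, of w]
        by (cases "x \<le> 0"; cases "w \<le> 0") (auto simp: abs_mult min_def)
      then show "(\<integral>w. norm (min w x * f x * g w) \<partial>lborel) = mean_min g x * f x"
        by (simp add: mean_min_def)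
    qed
    then show "integrable lborel (\<lambda>x. \<integral>w. norm (case (x, w) of (x, w) \<Rightarrow> min w x * f x * g w) \<partial>lborel)"
      using integrable_mean_min_mult[OF g f] by simp
    have "integrable lborel (\<lambda>w. f x * (min x w * g w))" for x
      using integrable_min_mult_density[OF g, of x] extended_density_eq_0[OF f, of x]
      by (cases "0 \<le> x") auto
    then show "AE x in lborel. integrable lborel (\<lambda>w. case (x, w) of (x, w) \<Rightarrow> min w x * f x * g w)"
      by (simp add: ac_simps min.commute)
  qed measurable
  have "overlap f g = (\<integral>w. (\<integral>x. min w x * f x * g w \<partial>lborel) \<partial>lborel)"
    by (simp add: overlap_def mean_min_def)
  also have "\<dots> = (\<integral>x. (\<integral>w. min w x * f x * g w \<partial>lborel) \<partial>lborel)"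
    by (rule lborel_pair.Fubini_integral[OF int])
  also have "\<dots> = (\<integral>x. (\<integral>w. f x * (min x w * g w) \<partial>lborel) \<partial>lborel)"
    by (simp add: ac_simps min.commute)
  also have "\<dots> = overlap g f"
    by (simp add: overlap_def mean_min_def ac_simps)
  finally show ?thesis .
qed

text \<open>The identity B(f,f) - B(g,g) = B(f-g, f+g) for a symmetric bilinear form. The difference
  is put on \<open>mean_min\<close>, whose evolution in time can be estimated, and the sum on the
  densities, which are bounded by M.\<close>

lemma overlap_diff:
  assumes f: "extended_density f" and g: "extended_density g"
  shows "overlap f f - overlap g g = (\<integral>w. (mean_min f w - mean_min g w) * (f w + g w) \<partial>lborel)"
    and "integrable lborel (\<lambda>w. (mean_min f w - mean_min g w) * (f w + g w))"
proof -
  note i = integrable_mean_min_mult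
  have eq: "(\<lambda>w. (mean_min f w - mean_min g w) * (f w + g w)) =
    (\<lambda>w. mean_min f w * f w - mean_min g w * g w + (mean_min f w * g w - mean_min g w * f w))"
    by (auto simp: algebra_simps)
  show "overlap f f - overlap g g = (\<integral>w. (mean_min f w - mean_min g w) * (f w + g w) \<partial>lborel)"
    unfolding eq using overlap_commute[OF f g] i[OF f f] i[OF f g] i[OF g f] i[OF g g]
    by (simp add: overlap_def)
  show "integrable lborel (\<lambda>w. (mean_min f w - mean_min g w) * (f w + g w))"
    unfolding eq using i[OF f f] i[OF f g] i[OF g f] i[OF g g] by auto
qed

text \<open>The same identity with the roles exchanged: the difference now falls on the densities,
  and the two values of \<open>mean_min\<close> add up to at most 2. It supplies the continuity in
  L^1 used at time 0.\<close>

lemma overlap_diff_le: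
  assumes f: "extended_density f" and g: "extended_density g"
  shows "\<bar>overlap f f - overlap g g\<bar> \<le> 2 * (\<integral>w. \<bar>f w - g w\<bar> \<partial>lborel)"
proof -
  note i = integrable_mean_min_mult
  have eq: "(\<lambda>w. (mean_min f w + mean_min g w) * (f w - g w)) =
    (\<lambda>w. mean_min f w * f w - mean_min g w * g w + (mean_min g w * f w - mean_min f w * g w))"
    by (auto simp: algebra_simps)
  have "overlap f f - overlap g g = (\<integral>w. (mean_min f w + mean_min g w) * (f w - g w) \<partial>lborel)"
    unfolding eq using overlap_commute[OF f g] i[OF f f] i[OF f g] i[OF g f] i[OF g g]
    by (simp add: overlap_def)
  moreover have "\<bar>\<integral>w. (mean_min f w + mean_min g w) * (f w - g w) \<partial>lborel\<bar> \<le> (\<integral>w. 2 * \<bar>f w - g w\<bar> \<partial>lborel)"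
  proof (rule order_trans[OF integral_abs_bound integral_mono'])
    show "integrable lborel (\<lambda>w. 2 * \<bar>f w - g w\<bar>)"
      using f g by (auto simp: extended_density_def)
    show "\<bar>(mean_min f w + mean_min g w) * (f w - g w)\<bar> \<le> 2 * \<bar>f w - g w\<bar>" for w
      using mean_min_nonneg[OF f, of w] mean_min_le_1[OF f, of w] 
        mean_min_nonneg[OF g, of w] mean_min_le_1[OF g, of w] 
        extended_density_eq_0[OF f, of w] extended_density_eq_0[OF g, of w]
      by (cases "w \<le> 0") (auto simp: abs_mult intro!: mult_right_mono)
  qed auto
  ultimately show ?thesis by simp
qed

section \<open>Tents as compactly supported test functions\<close>

text \<open>For \<open>0 < \<epsilon> < x < R\<close> the graph rises with slope 1 from
  \<open>\<epsilon>\<close> to \<open>x\<close>, stays at height \<open>x - \<epsilon>\<close> up to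
  \<open>R\<close>, and falls linearly to 0 at \<open>2 * R\<close>.\<close>

definition tent :: "real \<Rightarrow> real \<Rightarrow> real \<Rightarrow> real \<Rightarrow> real" where
  "tent \<epsilon> x R w = max 0 (min (min (w - \<epsilon>) (x - \<epsilon>)) ((x - \<epsilon>) / R * (2 * R - w)))"

text \<open>Two integrations by parts: if u'' = r and h is affine, then h u' - h' u is an
  antiderivative of h r.\<close>

lemma has_integral_affine_mult_second_deriv:
  fixes u v r :: "real \<Rightarrow> real"
  assumes "a \<le> b"
    and u: "\<And>w. w \<in> {a..b} \<Longrightarrow> (u has_real_derivative v w) (at w)"
    and v: "\<And>w. w \<in> {a..b} \<Longrightarrow> (v has_real_derivative r w) (at w)"
    and h: "\<And>w. w \<in> {a..b} \<Longrightarrow> h w = p * w + q"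
  shows "((\<lambda>w. h w * r w) has_integral
    ((p * b + q) * v b - p * u b - ((p * a + q) * v a - p * u a))) {a..b}"
proof -
  have "((\<lambda>w. (p * w + q) * r w) has_integral
    ((p * b + q) * v b - p * u b - ((p * a + q) * v a - p * u a))) {a..b}"
  proof (rule fundamental_theorem_of_calculus[OF \<open>a \<le> b\<close>])
    fix w assume w: "w \<in> {a..b}"
    have "((\<lambda>w. (p * w + q) * v w - p * u w) has_real_derivative (p * w + q) * r w) (at w)"
      by (rule derivative_eq_intros u[OF w] v[OF w] refl)+ (simp add: algebra_simps)
    then show "((\<lambda>w. (p * w + q) * v w - p * u w) has_vector_derivative (p * w + q) * r w) (at w within {a..b})"
      by (simp add: has_real_derivative_iff_has_vector_derivative has_vector_derivative_at_within)
  qed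
  then show ?thesis
    by (rule has_integral_eq[rotated]) (simp add: h)
qed

text \<open>Summing over the three affine pieces, the terms with \<open>v\<close> cancel at
  \<open>x\<close> and \<open>R\<close> because the tent is continuous, and vanish at both ends
  because the tent does. What remains is \<open>u\<close> at the four breakpoints, weighted by the
  jumps of the slope.\<close>

lemma has_integral_tent_mult_second_deriv:
  assumes order: "0 < \<epsilon>" "\<epsilon> < x" "x < R"
    and u: "\<And>w. w \<in> {\<epsilon>..2 * R} \<Longrightarrow> (u has_real_derivative v w) (at w)"
    and v: "\<And>w. w \<in> {\<epsilon>..2 * R} \<Longrightarrow> (v has_real_derivative r w) (at w)"
  shows "((\<lambda>w. tent \<epsilon> x R w * r w) has_integral
    (u \<epsilon> - u x + (x - \<epsilon>) / R * (u (2 * R) - u R))) {\<epsilon>..2 * R}"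
proof -
  have slope: "0 < (x - \<epsilon>) / R" "(x - \<epsilon>) / R * R = x - \<epsilon>"
    using order by auto
  \<comment> \<open>The falling leg lies above the plateau to the left of \<open>R\<close>, and
    between 0 and the plateau on [R, 2R]; hence the minimum picks the intended piece on each
    interval.\<close>
  have sl: "x - \<epsilon> \<le> (x - \<epsilon>) / R * (2 * R - w)" if "w \<le> R" for w
    using mult_left_mono[of R "2 * R - w" "(x - \<epsilon>) / R"] slope that by simp
  have sr: "(x - \<epsilon>) / R * (2 * R - w) \<le> x - \<epsilon>" "0 \<le> (x - \<epsilon>) / R * (2 * R - w)"
    if "R \<le> w" "w \<le> 2 * R" for w
    using mult_left_mono[of "2 * R - w" R "(x - \<epsilon>) / R"] slope that
    by (simp, intro mult_nonneg_nonneg) auto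
  have 1: "((\<lambda>w. tent \<epsilon> x R w * r w) has_integral
      ((1 * x + (-\<epsilon>)) * v x - 1 * u x - ((1 * \<epsilon> + (-\<epsilon>)) * v \<epsilon> - 1 * u \<epsilon>))) {\<epsilon>..x}"
  proof (rule has_integral_affine_mult_second_deriv)
    fix w assume "w \<in> {\<epsilon>..x}"
    then show "tent \<epsilon> x R w = 1 * w + (-\<epsilon>)"
      unfolding tent_def using sl[of w] order by (simp del: times_divide_eq_left)
  qed (use order u v in auto)
  have 2: "((\<lambda>w. tent \<epsilon> x R w * r w) has_integral
      ((0 * R + (x - \<epsilon>)) * v R - 0 * u R - ((0 * x + (x - \<epsilon>)) * v x - 0 * u x))) {x..R}"
  proof (rule has_integral_affine_mult_second_deriv)
    fix w assume "w \<in> {x..R}"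
    then show "tent \<epsilon> x R w = 0 * w + (x - \<epsilon>)"
      unfolding tent_def using sl[of w] order by (simp del: times_divide_eq_left)
  qed (use order u v in auto)
  have 3: "((\<lambda>w. tent \<epsilon> x R w * r w) has_integral
      ((- ((x - \<epsilon>) / R) * (2 * R) + 2 * (x - \<epsilon>)) * v (2 * R) - (- ((x - \<epsilon>) / R)) * u (2 * R)
       - ((- ((x - \<epsilon>) / R) * R + 2 * (x - \<epsilon>)) * v R - (- ((x - \<epsilon>) / R)) * u R))) {R..2 * R}"
  proof (rule has_integral_affine_mult_second_deriv)
    fix w assume w: "w \<in> {R..2 * R}"
    then have "tent \<epsilon> x R w = (x - \<epsilon>) / R * (2 * R - w)"
      unfolding tent_def using sr[of w] order by (simp del: times_divide_eq_left)
    also have "\<dots> = - ((x - \<epsilon>) / R) * w + 2 * (x - \<epsilon>)"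
      using order by (simp add: field_simps)
    finally show "tent \<epsilon> x R w = - ((x - \<epsilon>) / R) * w + 2 * (x - \<epsilon>)" .
  qed (use order u v in auto)
  have "((\<lambda>w. tent \<epsilon> x R w * r w) has_integral
      ((1 * x + (-\<epsilon>)) * v x - 1 * u x - ((1 * \<epsilon> + (-\<epsilon>)) * v \<epsilon> - 1 * u \<epsilon>)
      + ((0 * R + (x - \<epsilon>)) * v R - 0 * u R - ((0 * x + (x - \<epsilon>)) * v x - 0 * u x))
      + ((- ((x - \<epsilon>) / R) * (2 * R) + 2 * (x - \<epsilon>)) * v (2 * R) - (- ((x - \<epsilon>) / R)) * u (2 * R)
       - ((- ((x - \<epsilon>) / R) * R + 2 * (x - \<epsilon>)) * v R - (- ((x - \<epsilon>) / R)) * u R)))) {\<epsilon>..2 * R}"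
    using order by (intro has_integral_combine[OF _ _ has_integral_combine[OF _ _ 1 2] 3]) auto
  then show ?thesis
    by (rule has_integral_eq_rhs) (use order in \<open>simp add: field_simps\<close>)
qed

lemma tent_bounds:
  assumes "0 < \<epsilon>" "\<epsilon> < x" "x < R"
  shows "0 \<le> tent \<epsilon> x R w" "w \<notin> {\<epsilon>..2 * R} \<Longrightarrow> tent \<epsilon> x R w = 0"
    "0 \<le> w \<Longrightarrow> tent \<epsilon> x R w \<le> min w x"
proof -
  have "(x - \<epsilon>) / R * (2 * R - w) \<le> 0" if "2 * R < w"
    using assms that by (intro mult_nonneg_nonpos) auto
  then show "w \<notin> {\<epsilon>..2 * R} \<Longrightarrow> tent \<epsilon> x R w = 0"
    by (auto simp: tent_def min_def max_def)
qed (use assms in \<open>auto simp: tent_def\<close>)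

lemma continuous_on_tent: "continuous_on A (tent \<epsilon> x R)"
  unfolding tent_def by (intro continuous_intros)

lemma tent_tendsto_min:
  assumes "0 < x" "0 \<le> w"
  shows "(\<lambda>n. tent (x / (real n + 2)) x (x * (real n + 2)) w) \<longlonglongrightarrow> min w x"
proof -
  have 1: "(\<lambda>n. x / (real n + 2)) \<longlonglongrightarrow> 0" by real_asymp
  \<comment> \<open>The falling leg tends to \<open>2 * x\<close>, which exceeds
    \<open>min w x\<close>, so it drops out of the minimum in the limit.\<close>
  have "(\<lambda>n. (x - x / (real n + 2)) / (x * (real n + 2)) * (2 * (x * (real n + 2)) - w)) \<longlonglongrightarrow> 2 * x"
    using assms by real_asymp
  with 1 have "(\<lambda>n. tent (x / (real n + 2)) x (x * (real n + 2)) w) \<longlonglongrightarrow>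
      max 0 (min (min (w - 0) (x - 0)) (2 * x))"
    unfolding tent_def by (intro tendsto_max tendsto_min tendsto_diff tendsto_const)
  also have "max 0 (min (min (w - 0) (x - 0)) (2 * x)) = min w x"
    using assms by simp
  finally show ?thesis .
qed

text \<open>The shift by 2 keeps \<open>real n + 2\<close> above 1 already at \<open>n = 0\<close>,
  where a shift by 1 would make all three points of the strict chain coincide.\<close>

lemma tent_parameters:
  assumes "0 < x"
  shows "0 < x / (real n + 2)" "x / (real n + 2) < x" "x < x * (real n + 2)"
proof -
  have "x * 1 < x * (real n + 2)"
    using assms by (intro mult_strict_left_mono) auto
  then show "x < x * (real n + 2)" by simp
  then show "x / (real n + 2) < x" by (simp add: divide_less_eq)
qed (use assms in simp)

section \<open>Integration in time and a Gronwall inequality backward in time\<close>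

lemma set_integrable_interval_bounded:
  fixes f :: "real \<Rightarrow> real"
  assumes [measurable]: "f \<in> borel_measurable borel" and bound: "\<And>x. x \<in> {a..b} \<Longrightarrow> \<bar>f x\<bar> \<le> B"
  shows "set_integrable lborel {a..b} f"
proof (rule set_integrable_bound)
  show "set_integrable lborel {a..b} (\<lambda>x. B)"
    unfolding set_integrable_def by (rule borel_integrable_compact) auto
  show "set_borel_measurable lborel {a..b} f"
    unfolding set_borel_measurable_def by measurable
  show "AE x in lborel. x \<in> {a..b} \<longrightarrow> norm (f x) \<le> norm B"
    using bound by (intro AE_I2) fastforce
qed

text \<open>\<open>F\<close> is not assumed continuous: the bound \<open>F a \<le> c e\<^bsup>k(t-a)\<^esup> + q e\<^bsup>2k(t-a)\<^esup>\<close> holds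
  for \<open>q = 1\<close>, and inserting it into the integral inequality halves \<open>q\<close>.\<close>
lemma backward_gronwall:
  fixes F :: "real \<Rightarrow> real"
  assumes k: "0 \<le> k"
    and F_le_1: "\<And>\<tau>. \<tau> \<in> {s..t} \<Longrightarrow> F \<tau> \<le> 1"
    and F_int: "F integrable_on {s..t}"
    and F: "\<And>a. a \<in> {s..t} \<Longrightarrow> F a \<le> c + k * integral {a..t} F"
    and "0 \<le> c" and "s \<le> t"
  shows "F s \<le> c * exp (k * (t - s))"
proof -
  \<comment> \<open>Keeping the factor \<open>j\<close> in the integrand instead of dividing by it
    covers \<open>j = 0\<close>, a value that \<open>k\<close> may take.\<close>
  have exp_int: "((\<lambda>\<tau>. j * exp (j * (t - \<tau>))) has_integral (exp (j * (t - a)) - 1)) {a..t}"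
    if "a \<le> t" for a j :: real
  proof -
    have "((\<lambda>\<tau>. j * exp (j * (t - \<tau>))) has_integral (- exp (j * (t - t)) - (- exp (j * (t - a))))) {a..t}"
      by (rule fundamental_theorem_of_calculus[OF that])
        (auto intro!: derivative_eq_intros simp flip: has_real_derivative_iff_has_vector_derivative)
    then show ?thesis by simp
  qed
  have iter: "F a \<le> c * exp (k * (t - a)) + (1 / 2) ^ n * exp (2 * k * (t - a))"
    if "a \<in> {s..t}" for a n
    using that
  proof (induction n arbitrary: a)
    case 0
    have "exp 0 \<le> exp (2 * k * (t - a))"
      unfolding exp_le_cancel_iff using 0 k by (intro mult_nonneg_nonneg) auto
    moreover have "0 \<le> c * exp (k * (t - a))" using \<open>0 \<le> c\<close> by simp
    ultimately show ?case using F_le_1[OF 0] by (simp only: exp_zero power_0)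
  next
    case (Suc n)
    let ?G = "\<lambda>\<tau>. c * exp (k * (t - \<tau>)) + (1 / 2) ^ n * exp (2 * k * (t - \<tau>))"
    \<comment> \<open>The source of the halving: at rate \<open>2 * k\<close>,
      \<open>exp_int\<close> requires the factor \<open>2 * k\<close>, while the integral inequality
      provides only \<open>k\<close>.\<close>
    have "((\<lambda>\<tau>. c * (k * exp (k * (t - \<tau>))) + (1 / 2) ^ n / 2 * (2 * k * exp (2 * k * (t - \<tau>))))
        has_integral (c * (exp (k * (t - a)) - 1) + (1 / 2) ^ n / 2 * (exp (2 * k * (t - a)) - 1))) {a..t}"
      using Suc.prems by (intro has_integral_add has_integral_mult_right exp_int) auto
    then have G: "((\<lambda>\<tau>. k * ?G \<tau>)
        has_integral (c * (exp (k * (t - a)) - 1) + (1 / 2) ^ n / 2 * (exp (2 * k * (t - a)) - 1))) {a..t}"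
      by (simp add: algebra_simps)
    have sub: "{a..t} \<subseteq> {s..t}" using Suc.prems by auto
    have "F integrable_on {a..t}"
      using integrable_subinterval_real[OF F_int sub] .
    then have "((\<lambda>\<tau>. k * F \<tau>) has_integral (k * integral {a..t} F)) {a..t}"
      by (intro has_integral_mult_right integrable_integral)
    then have "k * integral {a..t} F \<le> c * (exp (k * (t - a)) - 1) + (1 / 2) ^ n / 2 * (exp (2 * k * (t - a)) - 1)"
      by (rule has_integral_le[OF _ G]) (use Suc.IH sub k in \<open>auto intro!: mult_left_mono\<close>)
    moreover have "0 \<le> (1 / 2 :: real) ^ n" by simp
    \<comment> \<open>The term \<open>- c\<close> cancels the \<open>c\<close> in the hypothesis on
      \<open>F\<close>; the other negative constant is discarded.\<close>
    moreover have "c * (exp (k * (t - a)) - 1) = c * exp (k * (t - a)) - c"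
      "(1 / 2) ^ n / 2 * (exp (2 * k * (t - a)) - 1)
        = (1 / 2) ^ Suc n * exp (2 * k * (t - a)) - (1 / 2) ^ n / 2"
      by (simp_all add: algebra_simps)
    ultimately show ?case using F[OF Suc.prems] by linarith
  qed
  have "(\<lambda>n. c * exp (k * (t - s)) + (1 / 2) ^ n * exp (2 * k * (t - s))) \<longlonglongrightarrow> c * exp (k * (t - s)) + 0 * exp (2 * k * (t - s))"
    by (intro tendsto_intros LIMSEQ_realpow_zero) auto
  then have "F s \<le> c * exp (k * (t - s)) + 0 * exp (2 * k * (t - s))"
    by (rule LIMSEQ_le_const) (use iter[of s] \<open>s \<le> t\<close> in auto)
  then show ?thesis by simp
qed

section \<open>From the essential supremum to a pointwise bound\<close>

text \<open>Continuity in wealth upgrades the almost-everywhere bound: for \<open>c\<close> strictly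
  between the norm and an exceeding value, the set where the solution exceeds \<open>c\<close> in
  absolute value is open and null, hence empty. Time 0 is left out because continuity is assumed
  only at positive times.\<close>

lemma solution_le_sup_norm:
  assumes sol: "yard_sale_solution \<gamma> T \<rho>" and fin: "sup_norm_upto T \<rho> < \<infinity>"
    and w: "0 < w" and \<tau>: "\<tau> \<in> {0<..T}"
  shows "\<rho> w \<tau> \<le> real_of_ereal (sup_norm_upto T \<rho>)"
proof -
  let ?S = "sup_norm_upto T \<rho>"
  have "continuous_on ({0<..} \<times> {0<..T}) (\<lambda>(w, t). \<rho> w t)"
    using sol unfolding yard_sale_solution_def by blast
  then have cont: "continuous_on {0<..} (\<lambda>w. \<rho> w \<tau>)"
    by (rule continuous_on_compose2[where f = "\<lambda>w. (w, \<tau>)" and g = "\<lambda>(w, t). \<rho> w t", simplified])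
      (use \<tau> in \<open>auto intro!: continuous_intros\<close>)
  have AE_S: "AE y in lborel. 0 < y \<longrightarrow> ereal \<bar>\<rho> y \<tau>\<bar> \<le> ?S"
  proof -
    have "AE y in restrict_space lborel {0<..}. ereal \<bar>\<rho> y \<tau>\<bar> \<le> Linf_norm (\<lambda>w. \<rho> w \<tau>)"
      unfolding Linf_norm_def by (rule esssup_AE)
    then have "AE y in lborel. 0 < y \<longrightarrow> ereal \<bar>\<rho> y \<tau>\<bar> \<le> Linf_norm (\<lambda>w. \<rho> w \<tau>)"
      by (simp add: AE_restrict_space_iff)
    moreover have "Linf_norm (\<lambda>w. \<rho> w \<tau>) \<le> ?S"
      unfolding sup_norm_upto_def using \<tau> by (intro SUP_upper) auto
    ultimately show ?thesis by (auto elim!: eventually_mono intro: order_trans)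
  qed
  have everywhere: "ereal \<bar>\<rho> y \<tau>\<bar> \<le> ?S" if "0 < y" for y
  proof (rule ccontr)
    assume "\<not> ereal \<bar>\<rho> y \<tau>\<bar> \<le> ?S"
    then obtain c where c: "?S < ereal c" "c < \<bar>\<rho> y \<tau>\<bar>"
      by (metis ereal_dense2 less_ereal.simps(1) not_le)
    let ?V = "(\<lambda>y. \<bar>\<rho> y \<tau>\<bar>) -` {c<..} \<inter> {0<..}"
    have "open ?V"
      using continuous_on_open_vimage[of "{0<..}" "\<lambda>y. \<bar>\<rho> y \<tau>\<bar>"] cont
      by (auto intro!: continuous_intros)
    moreover have "y \<in> ?V" using c that by auto
    moreover have "AE y in lebesgue. y \<in> - ?V"
    proof -
      have "AE y in lborel. y \<in> - ?V"
        using AE_S c(1)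
        by (elim eventually_mono) (auto simp: not_less dest: order_le_less_trans)
      then show ?thesis by (rule AE_completion)
    qed
    ultimately show False
      using mem_closed_if_AE_lebesgue[OF closed_Compl] by blast
  qed
  \<comment> \<open>Nonnegativity excludes minus infinity and \<open>fin\<close> plus infinity, so
    \<open>real_of_ereal\<close> returns the norm itself and not its default value 0.\<close>
  have "ereal 0 \<le> ?S" using everywhere[OF w] by (rule order_trans[rotated]) simp
  then obtain m where m: "?S = ereal m" using fin by (cases ?S) auto
  then show ?thesis using everywhere[OF w] by simp
qed

section \<open>Evolution of \<open>mean_min\<close> and \<open>overlap\<close> along a bounded
  solution\<close>

locale bounded_yard_sale =
  fixes \<gamma> T M :: real and \<rho> :: "real \<Rightarrow> real \<Rightarrow> real"
  assumes \<gamma>_nonneg: "0 \<le> \<gamma>"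
    and solution: "yard_sale_solution \<gamma> T \<rho>"
    and density: "\<tau> \<in> {0<..T} \<Longrightarrow> extended_density (\<lambda>w. if 0 < w then \<rho> w \<tau> else 0)"
    and bounded: "0 < w \<Longrightarrow> \<tau> \<in> {0<..T} \<Longrightarrow> \<rho> w \<tau> \<le> M"
begin

text \<open>The solution extended by zero to all real times and wealths, which makes it Borel measurable in
  both variables; the values at time 0 are cut off because \<open>\<rho> w 0\<close> need not fit continuously.\<close>
definition Q :: "real \<Rightarrow> real \<Rightarrow> real" where
  "Q \<tau> w = (if 0 < w \<and> \<tau> \<in> {0<..T} then \<rho> w \<tau> else 0)"

definition flux :: "real \<Rightarrow> real \<Rightarrow> real" where
  "flux \<tau> w = diffusion \<gamma> (\<lambda>x. \<rho> x \<tau>) w * \<rho> w \<tau>"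

lemma Q_eq: "\<tau> \<in> {0<..T} \<Longrightarrow> Q \<tau> = (\<lambda>w. if 0 < w then \<rho> w \<tau> else 0)"
  by (auto simp: Q_def)

lemma Q_density: "\<tau> \<in> {0<..T} \<Longrightarrow> extended_density (Q \<tau>)"
  using density by (simp add: Q_eq)

lemma Q_nonneg: "0 \<le> Q \<tau> w"
  using extended_density_nonneg[OF Q_density] by (cases "\<tau> \<in> {0<..T}") (auto simp: Q_def)

lemma M_nonneg: "0 < T \<Longrightarrow> 0 \<le> M"
  using bounded[of 1 T] Q_nonneg[of T 1] by (simp add: Q_def)

lemma continuous_on_solution: "continuous_on ({0<..} \<times> {0<..T}) (\<lambda>(w, t). \<rho> w t)"
  using solution unfolding yard_sale_solution_def by blast

lemma Q_measurable [measurable]: "(\<lambda>(\<tau>, w). Q \<tau> w) \<in> borel_measurable (borel \<Otimes>\<^sub>M borel)"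
proof -
  have "continuous_on ({0<..T} \<times> {0<..}) (\<lambda>z. (\<lambda>(w, t). \<rho> w t) (snd z, fst z))"
    by (rule continuous_on_compose2[OF continuous_on_solution]) (auto intro!: continuous_intros)
  then have "(\<lambda>z. indicator ({0<..T} \<times> {0<..}) z *\<^sub>R (\<lambda>(w, t). \<rho> w t) (snd z, fst z)) \<in> borel_measurable borel"
    by (intro borel_measurable_continuous_on_indicator) (auto simp flip: borel_prod intro!: pair_measureI)
  also have "(\<lambda>z. indicator ({0<..T} \<times> {0<..}) z *\<^sub>R (\<lambda>(w, t). \<rho> w t) (snd z, fst z)) = (\<lambda>(\<tau>, w). Q \<tau> w)"
    by (auto simp: Q_def indicator_def fun_eq_iff)
  finally show ?thesis by (simp add: borel_prod)
qed

lemma mean_min_Q_measurable [measurable]: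
  "(\<lambda>(\<tau>, w). mean_min (Q \<tau>) w) \<in> borel_measurable (borel \<Otimes>\<^sub>M borel)"
  unfolding mean_min_def by measurable

lemma overlap_Q_measurable [measurable]: "(\<lambda>\<tau>. overlap (Q \<tau>) (Q \<tau>)) \<in> borel_measurable borel"
  unfolding overlap_def by measurable

text \<open>The two upper bounds have different uses. The first keeps the product whose integral
  over wealth is \<open>overlap (Q \<tau>) (Q \<tau>)\<close>; the constant one is for the far
  breakpoint \<open>R\<close> of the tents, where uniform boundedness is enough.\<close>

lemma flux_bounds:
  assumes "\<tau> \<in> {0<..T}" "0 < w"
  shows "0 \<le> flux \<tau> w" "flux \<tau> w \<le> \<gamma> / 2 * (mean_min (Q \<tau>) w * Q \<tau> w)" "flux \<tau> w \<le> \<gamma> / 2 * M"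
proof -
  note D = diffusion_le[OF density[OF assms(1)] assms(2) \<gamma>_nonneg, folded Q_eq[OF assms(1)]]
  have q: "Q \<tau> w = \<rho> w \<tau>" "0 \<le> \<rho> w \<tau>" "\<rho> w \<tau> \<le> M"
    using assms Q_nonneg[of \<tau> w] bounded[of w \<tau>] by (auto simp: Q_def)
  show "0 \<le> flux \<tau> w" unfolding flux_def using D q by simp
  show 1: "flux \<tau> w \<le> \<gamma> / 2 * (mean_min (Q \<tau>) w * Q \<tau> w)"
    unfolding flux_def using mult_right_mono[OF D(2) q(2)] by (simp add: q(1) mult.assoc)
  have "mean_min (Q \<tau>) w * Q \<tau> w \<le> 1 * M"
    using mean_min_le_1[OF Q_density[OF assms(1)], of w] mean_min_nonneg[OF Q_density[OF assms(1)], of w] q assms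
    by (intro mult_mono) auto
  then have "\<gamma> / 2 * (mean_min (Q \<tau>) w * Q \<tau> w) \<le> \<gamma> / 2 * M"
    using \<gamma>_nonneg by (intro mult_left_mono) auto
  with 1 show "flux \<tau> w \<le> \<gamma> / 2 * M" by simp
qed

text \<open>The equation tested against a tent: the fundamental theorem in time, an exchange of
  integrals, and two integrations by parts in wealth. On the compact rectangle, away from wealth 0
  and time 0, the common value \<open>r\<close> of both sides is continuous, which justifies the
  exchange.\<close>

lemma has_integral_tent_time_difference:
  assumes order: "0 < \<epsilon>" "\<epsilon> < x" "x < R" and time: "0 < s" "s \<le> t" "t \<le> T"
  shows "((\<lambda>\<tau>. flux \<tau> \<epsilon> - flux \<tau> x + (x - \<epsilon>) / R * (flux \<tau> (2 * R) - flux \<tau> R)) has_integral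
    integral {\<epsilon>..2 * R} (\<lambda>w. tent \<epsilon> x R w * (\<rho> w t - \<rho> w s))) {s..t}"
proof -
  obtain r where r: "continuous_on ({0<..} \<times> {0<..T}) (\<lambda>(w, t). r w t)"
    and r_time: "\<And>w t. 0 < w \<Longrightarrow> t \<in> {0<..T} \<Longrightarrow> ((\<lambda>s. \<rho> w s) has_real_derivative r w t) (at t within {0<..T})"
    and r_flux: "\<And>w t. 0 < w \<Longrightarrow> t \<in> {0<..T} \<Longrightarrow> flux t field_differentiable (at w)"
      "\<And>w t. 0 < w \<Longrightarrow> t \<in> {0<..T} \<Longrightarrow> (deriv (flux t) has_real_derivative r w t) (at w)"
    using solution unfolding yard_sale_solution_def flux_def by blast
  have sub: "{s..t} \<subseteq> {0<..T}" "{\<epsilon>..2 * R} \<subseteq> {0<..}"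
    using time order by auto
  have cont1: "continuous_on ({s..t} \<times> {\<epsilon>..2 * R}) (\<lambda>(\<tau>, w). tent \<epsilon> x R w * r w \<tau>)"
  proof -
    have "continuous_on ({s..t} \<times> {\<epsilon>..2 * R}) (\<lambda>z. (\<lambda>(w, t). r w t) (snd z, fst z))"
      by (rule continuous_on_compose2[OF r]) (use sub in \<open>auto intro!: continuous_intros\<close>)
    moreover have "continuous_on ({s..t} \<times> {\<epsilon>..2 * R}) (\<lambda>z. tent \<epsilon> x R (snd z))"
      by (rule continuous_on_compose2[OF continuous_on_tent[of UNIV]]) (auto intro!: continuous_intros)
    ultimately show ?thesis
      unfolding case_prod_unfold by (intro continuous_intros) auto
  qed
  have space: "((\<lambda>w. tent \<epsilon> x R w * r w \<tau>) has_integral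
      (flux \<tau> \<epsilon> - flux \<tau> x + (x - \<epsilon>) / R * (flux \<tau> (2 * R) - flux \<tau> R))) {\<epsilon>..2 * R}"
    if "\<tau> \<in> {s..t}" for \<tau>
  proof (rule has_integral_tent_mult_second_deriv[OF order])
    fix w assume "w \<in> {\<epsilon>..2 * R}"
    then show "(flux \<tau> has_real_derivative deriv (flux \<tau>) w) (at w)"
      "(deriv (flux \<tau>) has_real_derivative r w \<tau>) (at w)"
      using that sub r_flux by (auto simp: DERIV_deriv_iff_field_differentiable subset_iff)
  qed
  have "integral {\<epsilon>..2 * R} (\<lambda>w. tent \<epsilon> x R w * (\<rho> w t - \<rho> w s))
      = integral {\<epsilon>..2 * R} (\<lambda>w. integral {s..t} (\<lambda>\<tau>. tent \<epsilon> x R w * r w \<tau>))"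
  proof (rule integral_cong)
    fix w assume w: "w \<in> {\<epsilon>..2 * R}"
    have "(r w has_integral (\<rho> w t - \<rho> w s)) {s..t}"
    proof (rule fundamental_theorem_of_calculus[OF \<open>s \<le> t\<close>])
      fix \<tau> assume "\<tau> \<in> {s..t}"
      then have "((\<lambda>s. \<rho> w s) has_real_derivative r w \<tau>) (at \<tau> within {s..t})"
        using w sub by (intro DERIV_subset[OF r_time]) auto
      then show "(\<rho> w has_vector_derivative r w \<tau>) (at \<tau> within {s..t})"
        by (simp add: has_real_derivative_iff_has_vector_derivative)
    qed
    then show "tent \<epsilon> x R w * (\<rho> w t - \<rho> w s) = integral {s..t} (\<lambda>\<tau>. tent \<epsilon> x R w * r w \<tau>)"
      by (simp add: integral_unique)
  qed
  also have "\<dots> = integral {s..t} (\<lambda>\<tau>. integral {\<epsilon>..2 * R} (\<lambda>w. tent \<epsilon> x R w * r w \<tau>))"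
    using integral_swap_continuous[of s \<epsilon> t "2 * R" "\<lambda>\<tau> w. tent \<epsilon> x R w * r w \<tau>"] cont1
    by (simp add: cbox_Pair_eq)
  finally have eq: "integral {\<epsilon>..2 * R} (\<lambda>w. tent \<epsilon> x R w * (\<rho> w t - \<rho> w s))
      = integral {s..t} (\<lambda>\<tau>. integral {\<epsilon>..2 * R} (\<lambda>w. tent \<epsilon> x R w * r w \<tau>))" .
  \<comment> \<open>Regularity of \<open>flux\<close> in time has not been established;
    integrability of the combination of its four values is inherited from this continuous parameter
    integral through \<open>space\<close>.\<close>
  have "continuous_on {s..t} (\<lambda>\<tau>. integral (cbox \<epsilon> (2 * R)) (\<lambda>w. tent \<epsilon> x R w * r w \<tau>))"
    by (rule integral_continuous_on_param) (use cont1 in simp)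
  then have "((\<lambda>\<tau>. integral {\<epsilon>..2 * R} (\<lambda>w. tent \<epsilon> x R w * r w \<tau>)) has_integral
      integral {\<epsilon>..2 * R} (\<lambda>w. tent \<epsilon> x R w * (\<rho> w t - \<rho> w s))) {s..t}"
    unfolding eq by (intro integrable_integral integrable_continuous_interval) simp
  then show ?thesis
    by (rule has_integral_eq[rotated]) (use space in \<open>auto simp: integral_unique\<close>)
qed

lemma set_integrable_mean_min_mult_time:
  assumes "0 < s" "t \<le> T" "0 < x"
  shows "set_integrable lborel {s..t} (\<lambda>\<tau>. mean_min (Q \<tau>) x * Q \<tau> x)"
proof (rule set_integrable_interval_bounded)
  show "(\<lambda>\<tau>. mean_min (Q \<tau>) x * Q \<tau> x) \<in> borel_measurable borel"
    by measurable
  fix \<tau> assume "\<tau> \<in> {s..t}"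
  then have \<tau>: "\<tau> \<in> {0<..T}" using assms by auto
  show "\<bar>mean_min (Q \<tau>) x * Q \<tau> x\<bar> \<le> 1 * M"
    using mean_min_nonneg[OF Q_density[OF \<tau>], of x] mean_min_le_1[OF Q_density[OF \<tau>], of x]
      Q_nonneg[of \<tau> x] bounded[OF \<open>0 < x\<close> \<tau>] \<open>0 < x\<close> \<tau>
    unfolding abs_mult by (intro mult_mono) (auto simp: Q_def)
qed

lemma set_integrable_overlap_Q:
  assumes "0 < s" "t \<le> T"
  shows "set_integrable lborel {s..t} (\<lambda>\<tau>. overlap (Q \<tau>) (Q \<tau>))"
proof (rule set_integrable_interval_bounded)
  show "\<bar>overlap (Q \<tau>) (Q \<tau>)\<bar> \<le> 1" if "\<tau> \<in> {s..t}" for \<tau>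
    using that assms by (simp add: overlap_nonneg overlap_le_1 Q_density)
qed measurable

lemma integral_tent_Q:
  assumes order: "0 < \<epsilon>" "\<epsilon> < x" "x < R" and \<tau>: "\<tau> \<in> {0<..T}"
  shows "(\<lambda>w. tent \<epsilon> x R w * \<rho> w \<tau>) integrable_on {\<epsilon>..2 * R}"
    "integral {\<epsilon>..2 * R} (\<lambda>w. tent \<epsilon> x R w * \<rho> w \<tau>) = (\<integral>w. tent \<epsilon> x R w * Q \<tau> w \<partial>lborel)"
proof -
  have "continuous_on {\<epsilon>..2 * R} (\<lambda>w. (\<lambda>(w, t). \<rho> w t) (w, \<tau>))"
    by (rule continuous_on_compose2[OF continuous_on_solution]) (use order \<tau> in \<open>auto intro!: continuous_intros\<close>)
  then have "set_integrable lborel {\<epsilon>..2 * R} (\<lambda>w. tent \<epsilon> x R w * \<rho> w \<tau>)"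
    unfolding set_integrable_def
    by (intro borel_integrable_compact) (auto intro!: continuous_intros continuous_on_tent)
  note set_borel_integral_eq_integral[OF this]
  moreover have "(LBINT w:{\<epsilon>..2 * R}. tent \<epsilon> x R w * \<rho> w \<tau>) = (\<integral>w. tent \<epsilon> x R w * Q \<tau> w \<partial>lborel)"
    unfolding set_lebesgue_integral_def
    by (intro Bochner_Integration.integral_cong)
      (use tent_bounds(2)[OF order] order \<tau> in \<open>auto simp: indicator_def Q_def\<close>)
  ultimately show "(\<lambda>w. tent \<epsilon> x R w * \<rho> w \<tau>) integrable_on {\<epsilon>..2 * R}"
    "integral {\<epsilon>..2 * R} (\<lambda>w. tent \<epsilon> x R w * \<rho> w \<tau>) = (\<integral>w. tent \<epsilon> x R w * Q \<tau> w \<partial>lborel)"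
    by auto
qed

text \<open>The flux values at \<open>\<epsilon>\<close> and \<open>2 * R\<close> have positive sign
  and are dropped, the one at \<open>x\<close> gives the main term, and the one at \<open>R\<close>,
  of weight at most \<open>x / R\<close>, gives the error term.\<close>

lemma tent_difference_ge:
  assumes order: "0 < \<epsilon>" "\<epsilon> < x" "x < R" and time: "0 < s" "s \<le> t" "t \<le> T"
  shows "- (\<gamma> / 2 * (LBINT \<tau>:{s..t}. mean_min (Q \<tau>) x * Q \<tau> x)) - x / R * (\<gamma> / 2 * M) * (t - s)
    \<le> (\<integral>w. tent \<epsilon> x R w * Q t w \<partial>lborel) - (\<integral>w. tent \<epsilon> x R w * Q s w \<partial>lborel)"
proof -
  have x: "0 < x" using order by simp
  have st: "s \<in> {0<..T}" "t \<in> {0<..T}" using time by auto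
  note g = set_borel_integral_eq_integral[OF set_integrable_mean_min_mult_time[OF time(1,3) x]]
  have "((\<lambda>\<tau>. - (\<gamma> / 2 * (mean_min (Q \<tau>) x * Q \<tau> x)) - x / R * (\<gamma> / 2 * M)) has_integral
      (- (\<gamma> / 2 * (LBINT \<tau>:{s..t}. mean_min (Q \<tau>) x * Q \<tau> x)) - (t - s) * (x / R * (\<gamma> / 2 * M)))) {s..t}"
    unfolding g(2)
    using has_integral_const_real[of "x / R * (\<gamma> / 2 * M)" s t] time
    by (intro has_integral_diff has_integral_neg has_integral_mult_right integrable_integral g(1)) auto
  then have "- (\<gamma> / 2 * (LBINT \<tau>:{s..t}. mean_min (Q \<tau>) x * Q \<tau> x)) - (t - s) * (x / R * (\<gamma> / 2 * M))
    \<le> integral {\<epsilon>..2 * R} (\<lambda>w. tent \<epsilon> x R w * (\<rho> w t - \<rho> w s))"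
  proof (rule has_integral_le[OF _ has_integral_tent_time_difference[OF order time]])
    fix \<tau> assume "\<tau> \<in> {s..t}"
    then have \<tau>: "\<tau> \<in> {0<..T}" using time by auto
    have "(x - \<epsilon>) / R * flux \<tau> R \<le> x / R * (\<gamma> / 2 * M)"
      using order flux_bounds(1,3)[OF \<tau>, of R]
      by (intro mult_mono divide_right_mono) auto
    moreover have "0 \<le> (x - \<epsilon>) / R * flux \<tau> (2 * R)"
      using order flux_bounds(1)[OF \<tau>, of "2 * R"] by simp
    moreover have "0 \<le> flux \<tau> \<epsilon>" "flux \<tau> x \<le> \<gamma> / 2 * (mean_min (Q \<tau>) x * Q \<tau> x)"
      using order flux_bounds[OF \<tau>] by auto
    ultimately show "- (\<gamma> / 2 * (mean_min (Q \<tau>) x * Q \<tau> x)) - x / R * (\<gamma> / 2 * M)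
        \<le> flux \<tau> \<epsilon> - flux \<tau> x + (x - \<epsilon>) / R * (flux \<tau> (2 * R) - flux \<tau> R)"
      unfolding right_diff_distrib by linarith
  qed
  also have "\<dots> = (\<integral>w. tent \<epsilon> x R w * Q t w \<partial>lborel) - (\<integral>w. tent \<epsilon> x R w * Q s w \<partial>lborel)"
    unfolding right_diff_distrib
    using integral_tent_Q[OF order st(1)] integral_tent_Q[OF order st(2)] by (simp add: Henstock_Kurzweil_Integration.integral_diff)
  finally show ?thesis by (simp add: mult.commute)
qed

text \<open>Dominated convergence, since every tent lies below \<open>min x w\<close> at positive
  wealth.\<close>

lemma tent_integral_tendsto_mean_min:
  assumes x: "0 < x" and \<tau>: "\<tau> \<in> {0<..T}"
  shows "(\<lambda>n. \<integral>w. tent (x / (real n + 2)) x (x * (real n + 2)) w * Q \<tau> w \<partial>lborel) \<longlonglongrightarrow> mean_min (Q \<tau>) x"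
  unfolding mean_min_def
proof (rule integral_dominated_convergence[where w = "\<lambda>w. min x w * Q \<tau> w"])
  note [measurable] = extended_density_measurable[OF Q_density[OF \<tau>]]
  show "integrable lborel (\<lambda>w. min x w * Q \<tau> w)"
    using x by (intro integrable_min_mult_density Q_density \<tau>) auto
  show "AE w in lborel. (\<lambda>n. tent (x / (real n + 2)) x (x * (real n + 2)) w * Q \<tau> w) \<longlonglongrightarrow> min x w * Q \<tau> w"
  proof (intro AE_I2)
    fix w :: real
    show "(\<lambda>n. tent (x / (real n + 2)) x (x * (real n + 2)) w * Q \<tau> w) \<longlonglongrightarrow> min x w * Q \<tau> w"
    proof (cases "0 < w")
      case True
      then show ?thesis
        using tent_tendsto_min[OF x, of w] by (intro tendsto_mult tendsto_const) (simp add: min.commute)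
    qed (simp add: Q_def)
  qed
  show "AE w in lborel. norm (tent (x / (real n + 2)) x (x * (real n + 2)) w * Q \<tau> w) \<le> min x w * Q \<tau> w" for n
  proof (intro AE_I2)
    fix w :: real
    have "0 \<le> tent (x / (real n + 2)) x (x * (real n + 2)) w"
      "0 < w \<Longrightarrow> tent (x / (real n + 2)) x (x * (real n + 2)) w \<le> min x w"
      using tent_bounds[OF tent_parameters[OF x, of n], of w] by (auto simp: min.commute)
    then show "norm (tent (x / (real n + 2)) x (x * (real n + 2)) w * Q \<tau> w) \<le> min x w * Q \<tau> w"
      using Q_nonneg[of \<tau> w] by (cases "0 < w") (simp_all add: abs_mult mult_right_mono Q_def del: min_less_iff_conj)
  qed
  have "tent \<epsilon> y R \<in> borel_measurable borel" for \<epsilon> y R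
    by (intro borel_measurable_continuous_onI continuous_on_tent)
  note [measurable] = this
  show "(\<lambda>w. tent (x / (real n + 2)) x (x * (real n + 2)) w * Q \<tau> w) \<in> borel_measurable lborel" for n
    by measurable
  show "(\<lambda>w. min x w * Q \<tau> w) \<in> borel_measurable lborel"
    by measurable
qed

text \<open>The limit of \<open>tent_difference_ge\<close>: with \<open>R = x * (real n + 2)\<close>
  the error has weight \<open>1 / (real n + 2)\<close>. This is the time-integrated, one-sided form
  of the formal identity for d/dt A_t.\<close>

lemma mean_min_difference_ge:
  assumes x: "0 < x" and time: "0 < s" "s \<le> t" "t \<le> T"
  shows "- (\<gamma> / 2 * (LBINT \<tau>:{s..t}. mean_min (Q \<tau>) x * Q \<tau> x)) \<le> mean_min (Q t) x - mean_min (Q s) x"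
proof -
  let ?I = "\<gamma> / 2 * (LBINT \<tau>:{s..t}. mean_min (Q \<tau>) x * Q \<tau> x)"
  have "(\<lambda>n. - ?I - x / (x * (real n + 2)) * (\<gamma> / 2 * M) * (t - s)) \<longlonglongrightarrow> - ?I - 0 * (\<gamma> / 2 * M) * (t - s)"
    by (intro tendsto_intros, use x in real_asymp)
  moreover have "(\<lambda>n. (\<integral>w. tent (x / (real n + 2)) x (x * (real n + 2)) w * Q t w \<partial>lborel)
      - (\<integral>w. tent (x / (real n + 2)) x (x * (real n + 2)) w * Q s w \<partial>lborel))
      \<longlonglongrightarrow> mean_min (Q t) x - mean_min (Q s) x"
    using time by (intro tendsto_diff tent_integral_tendsto_mean_min x) auto
  ultimately have "- ?I - 0 * (\<gamma> / 2 * M) * (t - s) \<le> mean_min (Q t) x - mean_min (Q s) x"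
    by (rule LIMSEQ_le) (blast intro: tent_difference_ge[OF tent_parameters[OF x] time])
  then show ?thesis by simp
qed

text \<open>\<open>mean_min_difference_ge\<close> is multiplied by \<open>Q t x + Q s x\<close>,
  which is at most \<open>2 * M\<close>, and integrated over \<open>x\<close>. The factors
  \<open>\<gamma> / 2\<close> and \<open>2 * M\<close> combine to \<open>\<gamma> * M\<close>, and
  Fubini turns the double integral into the time integral of \<open>overlap\<close>.\<close>

lemma overlap_difference_ge:
  assumes time: "0 < s" "s \<le> t" "t \<le> T"
  shows "- (\<gamma> * M * (LBINT \<tau>:{s..t}. overlap (Q \<tau>) (Q \<tau>))) \<le> overlap (Q t) (Q t) - overlap (Q s) (Q s)"
proof -
  have st: "s \<in> {0<..T}" "t \<in> {0<..T}" using time by auto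
  \<comment> \<open>The indicator puts the time interval into the integrand, so that Fubini applies
    on the whole plane.\<close>
  define h where "h \<tau> x = indicator {s..t} \<tau> *\<^sub>R (mean_min (Q \<tau>) x * Q \<tau> x)" for \<tau> x
  have h_nonneg: "0 \<le> h \<tau> x" for \<tau> x
  proof (cases "0 < x \<and> \<tau> \<in> {0<..T}")
    case True
    then show ?thesis
      using mean_min_nonneg[OF Q_density, of \<tau> x] Q_nonneg[of \<tau> x] by (simp add: h_def)
  next
    case False
    then have "Q \<tau> x = 0" by (simp only: Q_def if_False)
    then show ?thesis by (simp add: h_def)
  qed
  have h_overlap: "(\<integral>x. h \<tau> x \<partial>lborel) = indicator {s..t} \<tau> *\<^sub>R overlap (Q \<tau>) (Q \<tau>)" for \<tau>
    by (simp add: h_def overlap_def)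
  have int: "integrable (lborel \<Otimes>\<^sub>M lborel) (\<lambda>(\<tau>, x). h \<tau> x)"
  proof (rule lborel_pair.Fubini_integrable)
    show "(\<lambda>(\<tau>, x). h \<tau> x) \<in> borel_measurable (lborel \<Otimes>\<^sub>M lborel)"
      unfolding h_def by measurable
    show "integrable lborel (\<lambda>\<tau>. \<integral>x. norm (case (\<tau>, x) of (\<tau>, x) \<Rightarrow> h \<tau> x) \<partial>lborel)"
      using h_nonneg set_integrable_overlap_Q[OF time(1,3)] by (simp add: h_overlap set_integrable_def)
    have "integrable lborel (h \<tau>)" for \<tau>
    proof (cases "\<tau> \<in> {s..t}")
      case True
      then have "\<tau> \<in> {0<..T}" using time by auto
      with True show ?thesis
        unfolding h_def by (simp add: integrable_mean_min_mult Q_density)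
    next
      case False
      then have "h \<tau> = (\<lambda>x. 0)" by (auto simp: h_def)
      then show ?thesis by simp
    qed
    then show "AE \<tau> in lborel. integrable lborel (\<lambda>x. case (\<tau>, x) of (\<tau>, x) \<Rightarrow> h \<tau> x)"
      by simp
  qed
  have eq: "(LBINT \<tau>:{s..t}. overlap (Q \<tau>) (Q \<tau>)) = (\<integral>x. (\<integral>\<tau>. h \<tau> x \<partial>lborel) \<partial>lborel)"
    unfolding lborel_pair.Fubini_integral[OF int] h_overlap set_lebesgue_integral_def ..
  have "(\<integral>x. - (\<gamma> * M * (\<integral>\<tau>. h \<tau> x \<partial>lborel)) \<partial>lborel)
      \<le> (\<integral>x. (mean_min (Q t) x - mean_min (Q s) x) * (Q t x + Q s x) \<partial>lborel)"
  proof (rule integral_mono)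
    show "integrable lborel (\<lambda>x. - (\<gamma> * M * (\<integral>\<tau>. h \<tau> x \<partial>lborel)))"
      using lborel_pair.integrable_snd[OF int] by auto
    show "integrable lborel (\<lambda>x. (mean_min (Q t) x - mean_min (Q s) x) * (Q t x + Q s x))"
      by (rule overlap_diff(2)[OF Q_density Q_density]) (use st in auto)
    fix x :: real
    show "- (\<gamma> * M * (\<integral>\<tau>. h \<tau> x \<partial>lborel)) \<le> (mean_min (Q t) x - mean_min (Q s) x) * (Q t x + Q s x)"
    proof (cases "0 < x")
      case True
      let ?U = "\<integral>\<tau>. h \<tau> x \<partial>lborel"
      have U: "0 \<le> ?U" using h_nonneg by simp
      have "Q t x + Q s x \<le> 2 * M" "0 \<le> Q t x + Q s x"
        using bounded[OF True st(1)] bounded[OF True st(2)] Q_nonneg[of s x] Q_nonneg[of t x] st True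
        by (auto simp: Q_def)
      then have "\<gamma> / 2 * ?U * (Q t x + Q s x) \<le> \<gamma> / 2 * ?U * (2 * M)"
        using U \<gamma>_nonneg by (intro mult_left_mono) auto
      moreover have "- (\<gamma> / 2 * ?U) * (Q t x + Q s x) \<le> (mean_min (Q t) x - mean_min (Q s) x) * (Q t x + Q s x)"
        using mean_min_difference_ge[OF True time] \<open>0 \<le> Q t x + Q s x\<close>
        unfolding h_def set_lebesgue_integral_def by (intro mult_right_mono) auto
      moreover have "\<gamma> / 2 * ?U * (2 * M) = \<gamma> * M * ?U"
        "- (\<gamma> / 2 * ?U) * (Q t x + Q s x) = - (\<gamma> / 2 * ?U * (Q t x + Q s x))"
        by simp_all
      ultimately show ?thesis by linarith
    qed (simp add: h_def Q_def)
  qed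
  then show ?thesis
    by (simp add: eq overlap_diff(1)[OF Q_density[OF st(2)] Q_density[OF st(1)]])
qed

text \<open>Rearranged, \<open>overlap_difference_ge\<close> bounds an earlier value by a later one
  plus an integral; this is the hypothesis of \<open>backward_gronwall\<close> with
  \<open>k = \<gamma> * M\<close> and the value at time \<open>t\<close> as
  \<open>c\<close>.\<close>

lemma overlap_exp_bound:
  assumes time: "0 < s" "s \<le> t" "t \<le> T"
  shows "overlap (Q s) (Q s) \<le> overlap (Q t) (Q t) * exp (\<gamma> * M * (t - s))"
proof (rule backward_gronwall[where F = "\<lambda>\<tau>. overlap (Q \<tau>) (Q \<tau>)"])
  show "0 \<le> \<gamma> * M" using \<gamma>_nonneg M_nonneg time by simp
  show "(\<lambda>\<tau>. overlap (Q \<tau>) (Q \<tau>)) integrable_on {s..t}"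
    using set_borel_integral_eq_integral(1)[OF set_integrable_overlap_Q[OF time(1,3)]] .
  show "overlap (Q \<tau>) (Q \<tau>) \<le> 1" if "\<tau> \<in> {s..t}" for \<tau>
    using that time by (auto intro!: overlap_le_1 Q_density)
  show "overlap (Q a) (Q a) \<le> overlap (Q t) (Q t) + \<gamma> * M * integral {a..t} (\<lambda>\<tau>. overlap (Q \<tau>) (Q \<tau>))"
    if "a \<in> {s..t}" for a
    using overlap_difference_ge[of a t] that time 
      set_borel_integral_eq_integral(2)[OF set_integrable_overlap_Q[of a t]] by auto
qed (use time in \<open>auto intro!: overlap_nonneg Q_density\<close>)

text \<open>The limit of \<open>overlap_exp_bound\<close> as s tends to 0 from the right, where
  \<open>overlap_diff_le\<close> turns L^1 attainment of the initial datum into convergence of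
  \<open>overlap\<close>. The datum is named \<open>p0\<close> because \<open>Q 0\<close> vanishes
  by definition.\<close>

lemma initial_overlap_exp_bound:
  fixes p0 :: "real \<Rightarrow> real"
  defines "p0 \<equiv> (\<lambda>w. if 0 < w then \<rho> w 0 else 0)"
  assumes p0: "extended_density p0" and t: "t \<in> {0<..T}"
  shows "overlap p0 p0 \<le> overlap (Q t) (Q t) * exp (\<gamma> * M * t)"
proof -
  have L1: "((\<lambda>t. LBINT w:{0<..}. \<bar>\<rho> w t - \<rho> w 0\<bar>) \<longlongrightarrow> 0) (at_right 0)"
    using solution unfolding yard_sale_solution_def by blast
  have ev: "eventually (\<lambda>s. s \<in> {0<..t}) (at_right 0)"
    using eventually_at_right_less[of 0] eventually_at_right_real[of 0 t] t
    by (auto elim!: eventually_mono)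
  have "((\<lambda>s. overlap (Q s) (Q s) - overlap p0 p0) \<longlongrightarrow> 0) (at_right 0)"
  proof (rule tendsto_rabs_zero_cancel, rule tendsto_sandwich[OF _ _ tendsto_const])
    show "((\<lambda>s. 2 * (LBINT w:{0<..}. \<bar>\<rho> w s - \<rho> w 0\<bar>)) \<longlongrightarrow> 0) (at_right 0)"
      using tendsto_mult_right_zero[OF L1] .
    show "\<forall>\<^sub>F s in at_right 0. \<bar>overlap (Q s) (Q s) - overlap p0 p0\<bar> \<le> 2 * (LBINT w:{0<..}. \<bar>\<rho> w s - \<rho> w 0\<bar>)"
      using ev
    proof (elim eventually_mono)
      fix s assume "s \<in> {0<..t}"
      then have s: "s \<in> {0<..T}" using t by auto
      have "(\<integral>w. \<bar>Q s w - p0 w\<bar> \<partial>lborel) = (LBINT w:{0<..}. \<bar>\<rho> w s - \<rho> w 0\<bar>)"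
        unfolding set_lebesgue_integral_def Q_eq[OF s] p0_def
        by (intro Bochner_Integration.integral_cong) (auto simp: indicator_def)
      then show "\<bar>overlap (Q s) (Q s) - overlap p0 p0\<bar> \<le> 2 * (LBINT w:{0<..}. \<bar>\<rho> w s - \<rho> w 0\<bar>)"
        using overlap_diff_le[OF Q_density[OF s] p0] by simp
    qed
  qed simp
  then have lim: "((\<lambda>s. overlap (Q s) (Q s)) \<longlongrightarrow> overlap p0 p0) (at_right 0)"
    by (simp add: LIM_zero_iff)
  have "((\<lambda>s. overlap (Q t) (Q t) * exp (\<gamma> * M * (t - s))) \<longlongrightarrow> overlap (Q t) (Q t) * exp (\<gamma> * M * (t - 0))) (at_right 0)"
    by (intro tendsto_intros)
  then have "overlap p0 p0 \<le> overlap (Q t) (Q t) * exp (\<gamma> * M * (t - 0))"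
    by (rule tendsto_le[OF trivial_limit_at_right_real _ lim]) (use ev t in \<open>auto elim!: eventually_mono intro!: overlap_exp_bound\<close>)
  then show ?thesis by simp
qed

end

section \<open>The bound for the Gini coefficient\<close>

theorem claim4p6:
  fixes \<gamma> T t :: real and \<rho> :: "real \<Rightarrow> real \<Rightarrow> real"
  defines "M \<equiv> real_of_ereal (sup_norm_upto T \<rho>)"
  assumes "0 < \<gamma>" and "\<gamma> < 1" and "0 < T"
    and "\<And>s. s \<in> {0..T} \<Longrightarrow> wealth_density (\<lambda>w. \<rho> w s)"
    and "yard_sale_solution \<gamma> T \<rho>"
    and "sup_norm_upto T \<rho> < \<infinity>"
    and "t \<in> {0<..T}"
  shows "gini (\<lambda>w. \<rho> w t) \<le>
           gini (\<lambda>w. \<rho> w 0) * exp (- \<gamma> * M * t) + (exp (\<gamma> * M * t) - 1) / exp (\<gamma> * M * t)"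
proof -
  interpret bounded_yard_sale \<gamma> T M \<rho>
  proof
    show "extended_density (\<lambda>w. if 0 < w then \<rho> w \<tau> else 0)" if "\<tau> \<in> {0<..T}" for \<tau>
      using assms(5)[of \<tau>] that by (intro extended_density_if) auto
    show "\<rho> w \<tau> \<le> M" if "0 < w" "\<tau> \<in> {0<..T}" for w \<tau>
      unfolding M_def using solution_le_sup_norm[OF assms(6,7) that] .
  qed (use assms in auto)
  let ?p = "\<lambda>w. if 0 < w then \<rho> w 0 else 0"
  \<comment> \<open>With F = 1 - G, the right-hand side of the claim equals 1 - F(0) exp(-
    \<open>\<gamma>\<close> M t), so the claim is this inequality divided by the
    exponential.\<close>
  have "overlap ?p ?p \<le> overlap (Q t) (Q t) * exp (\<gamma> * M * t)"
    using assms by (intro initial_overlap_exp_bound extended_density_if) auto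
  moreover have "gini (\<lambda>w. \<rho> w t) = 1 - overlap (Q t) (Q t)" "gini (\<lambda>w. \<rho> w 0) = 1 - overlap ?p ?p"
    using gini_eq_overlap[of "\<lambda>w. \<rho> w t"] gini_eq_overlap[of "\<lambda>w. \<rho> w 0"] by (simp_all only: Q_eq[OF assms(8)])
  moreover have "exp (- \<gamma> * M * t) = 1 / exp (\<gamma> * M * t)"
    by (simp add: exp_minus inverse_eq_divide)
  ultimately show ?thesis
    by (simp only:) (simp add: divide_simps algebra_simps)
qed

end
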